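(* Let $r\in(0,\tfrac12)$, let $\mathcal{S}_r=\{S_1,\dots,S_{2^{2n+2}}\}$ be the family of the $2^{2n+2}$ similarities $\tau_{(z_j,k/4)}\circ\delta_r$ of $\mathbb{H}^n$, $j=1,\dots,2^{2n}$, $k=0,1,2,3$, where $z_1,\dots,z_{2^{2n}}$ are the distinct points of $\{0,1-r\}^{2n}\subset\mathbb{R}^{2n}$, and let $K_r$ be the self-similar set (the nonempty compact set) defined by $$K_r=\bigcup_{j=1}^{2^{2n+2}}S_j(K_r).$$ Then the sets $S_j(K_r)$, $j=1,\dots,2^{2n+2}$, are pairwise disjoint, $$K_r=\bigcap_{k=1}^{\infty}\ \bigcup_{j_1,\dots,j_k=1}^{2^{2n+2}}S_{j_1}\circ\dots\circ S_{j_k}(K_r),$$ and $$0<\mathcal{H}^a(K_r)<\infty\quad\text{with}\quad a=\frac{(2n+2)\log 2}{\log(1/r)}.$$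
   Context: $n\ge1$ is an integer. The Heisenberg group $\mathbb{H}^n$ is $\mathbb{R}^{2n+1}$, with points $p=(p',p_{2n+1})$, $p'\in\mathbb{R}^{2n}$, and group law $p\cdot q=(p'+q',\,p_{2n+1}+q_{2n+1}+A(p,q))$, where $A(p,q)=-2\sum_{i=1}^n(p_iq_{i+n}-p_{i+n}q_i)$. Put $\|p\|=(|p'|^4+p_{2n+1}^2)^{1/4}$ and $d(p,q)=\|p^{-1}\cdot q\|$, a left-invariant metric. $\mathcal{H}^a$ is the $a$-dimensional Hausdorff measure with respect to $d$. Left translations: $\tau_q(p)=q\cdot p$. Dilations: $\delta_r(p)=(rp',r^2p_{2n+1})$, $r>0$. *)

theory Defs
  imports "HOL-Analysis.Analysis"
begin

section \<open>The Heisenberg group\<close>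

text \<open>
  The index type \<^typ>\<open>'n\<close> has \<open>n = CARD('n)\<close> elements, so that \<open>n \<ge> 1\<close> is arbitrary. The coordinates
  \<open>p\<^sub>1, \<dots>, p\<^sub>n\<close> and \<open>p\<^sub>n\<^sub>+\<^sub>1, \<dots>, p\<^sub>2\<^sub>n\<close> of \<open>p' \<in> \<real>\<^sup>2\<^sup>n\<close> are those with index \<open>Inl i\<close> and \<open>Inr i\<close>.
  The points form a new type, and not a product type, because they carry the metric \<open>d\<close> instead
  of the Euclidean one.
\<close>

datatype 'n::finite heis = Heis (horiz: "real ^ ('n + 'n)") (vert: real)

definition heis_form :: "'n::finite heis \<Rightarrow> 'n heis \<Rightarrow> real" where
  "heis_form p q =
     - 2 * (\<Sum>i\<in>UNIV. horiz p $ Inl i * horiz q $ Inr i - horiz p $ Inr i * horiz q $ Inl i)"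

definition heis_mult :: "'n::finite heis \<Rightarrow> 'n heis \<Rightarrow> 'n heis" (infixl "\<cdot>\<^sub>H" 70) where
  "p \<cdot>\<^sub>H q = Heis (horiz p + horiz q) (vert p + vert q + heis_form p q)"

definition heis_one :: "'n::finite heis" where
  "heis_one = Heis 0 0"

definition heis_inv :: "'n::finite heis \<Rightarrow> 'n heis" where
  "heis_inv p = Heis (- horiz p) (- vert p)"

definition heis_norm :: "'n::finite heis \<Rightarrow> real" where
  "heis_norm p = root 4 (norm (horiz p) ^ 4 + (vert p)\<^sup>2)"

definition heis_translate :: "'n::finite heis \<Rightarrow> 'n heis \<Rightarrow> 'n heis" where
  "heis_translate q p = q \<cdot>\<^sub>H p"

definition heis_dilate :: "real \<Rightarrow> 'n::finite heis \<Rightarrow> 'n heis" where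
  "heis_dilate r p = Heis (r *\<^sub>R horiz p) (r\<^sup>2 * vert p)"

lemma horiz_heis_mult [simp]: "horiz (p \<cdot>\<^sub>H q) = horiz p + horiz q"
  and vert_heis_mult: "vert (p \<cdot>\<^sub>H q) = vert p + vert q + heis_form p q"
  by (simp_all add: heis_mult_def)

lemma horiz_heis_inv [simp]: "horiz (heis_inv p) = - horiz p"
  and vert_heis_inv [simp]: "vert (heis_inv p) = - vert p"
  by (simp_all add: heis_inv_def)

lemma heis_mult_assoc: "(p \<cdot>\<^sub>H q) \<cdot>\<^sub>H s = p \<cdot>\<^sub>H (q \<cdot>\<^sub>H s)"
  by (rule heis.expand)
    (simp add: vert_heis_mult heis_form_def algebra_simps sum.distrib sum_subtractf)

lemma heis_mult_one [simp]: "heis_one \<cdot>\<^sub>H p = p" "p \<cdot>\<^sub>H heis_one = p"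
  by (rule heis.expand; simp add: vert_heis_mult heis_form_def heis_one_def)+

lemma heis_mult_inv [simp]: "heis_inv p \<cdot>\<^sub>H p = heis_one" "p \<cdot>\<^sub>H heis_inv p = heis_one"
  by (rule heis.expand; simp add: vert_heis_mult heis_form_def heis_one_def mult.commute)+

lemma heis_inv_inv [simp]: "heis_inv (heis_inv p) = p"
  by (simp add: heis_inv_def)

lemma heis_inv_mult: "heis_inv (p \<cdot>\<^sub>H q) = heis_inv q \<cdot>\<^sub>H heis_inv p"
  by (rule heis.expand)
    (simp add: vert_heis_mult heis_form_def algebra_simps sum.distrib sum_subtractf)

lemma heis_norm_nonneg [simp]: "0 \<le> heis_norm p"
  by (simp add: heis_norm_def)

lemma heis_norm_power4: "heis_norm p ^ 4 = norm (horiz p) ^ 4 + (vert p)\<^sup>2"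
  by (simp add: heis_norm_def)

lemma heis_norm_inv [simp]: "heis_norm (heis_inv p) = heis_norm p"
  by (simp add: heis_norm_def)

lemma heis_norm_eq_0_iff [simp]: "heis_norm p = 0 \<longleftrightarrow> p = heis_one"
proof
  assume "heis_norm p = 0"
  then have "norm (horiz p) ^ 4 + (vert p)\<^sup>2 = 0"
    using heis_norm_power4[of p] by simp
  then have "norm (horiz p) ^ 4 = 0" "(vert p)\<^sup>2 = 0"
    by (simp_all add: add_nonneg_eq_0_iff)
  then show "p = heis_one"
    by (simp add: heis_one_def heis.expand)
qed (simp add: heis_norm_def heis_one_def)

lemma norm_horiz_le: "norm (horiz p) \<le> heis_norm p"
  by (rule power_le_imp_le_base[of _ 3]) (simp_all add: heis_norm_power4)

lemma inner_sum_index: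
  "(x :: real ^ ('n::finite + 'n)) \<bullet> y = (\<Sum>i\<in>UNIV. x $ Inl i * y $ Inl i + x $ Inr i * y $ Inr i)"
  unfolding inner_vec_def UNIV_Plus_UNIV[symmetric]
  by (subst sum.Plus) (simp_all add: sum.distrib)

lemma heis_form_Cauchy_Schwarz:
  "(2 * (horiz p \<bullet> horiz q))\<^sup>2 + (heis_form p q)\<^sup>2 \<le> (2 * norm (horiz p) * norm (horiz q))\<^sup>2"
proof -
  define z w where "z = horiz p" and "w = horiz q"
  define v :: "real ^ ('a + 'a)" where
    "v = (\<chi> i. case i of Inl j \<Rightarrow> w $ Inr j | Inr j \<Rightarrow> - w $ Inl j)"
  define a b where "a = z \<bullet> w" and "b = z \<bullet> v"
  have form: "heis_form p q = - 2 * b"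
    by (simp add: heis_form_def b_def inner_sum_index v_def z_def w_def)
  have wv: "w \<bullet> v = 0"
    by (simp add: inner_sum_index v_def mult.commute)
  have vv: "v \<bullet> v = w \<bullet> w"
    by (simp add: inner_sum_index v_def add.commute)
  have "(a\<^sup>2 + b\<^sup>2)\<^sup>2 = (z \<bullet> (a *\<^sub>R w + b *\<^sub>R v))\<^sup>2"
    by (simp add: inner_add_right a_def b_def power2_eq_square)
  also have "\<dots> \<le> (z \<bullet> z) * ((a *\<^sub>R w + b *\<^sub>R v) \<bullet> (a *\<^sub>R w + b *\<^sub>R v))"
    by (rule Cauchy_Schwarz_ineq)
  also have "(a *\<^sub>R w + b *\<^sub>R v) \<bullet> (a *\<^sub>R w + b *\<^sub>R v) = (a\<^sup>2 + b\<^sup>2) * (w \<bullet> w)"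
    by (simp add: inner_add_left inner_add_right wv inner_commute[of v w] vv
        power2_eq_square algebra_simps)
  finally have *: "(a\<^sup>2 + b\<^sup>2) * (a\<^sup>2 + b\<^sup>2) \<le> (a\<^sup>2 + b\<^sup>2) * ((z \<bullet> z) * (w \<bullet> w))"
    by (simp add: power2_eq_square mult_ac)
  have "a\<^sup>2 + b\<^sup>2 \<le> (z \<bullet> z) * (w \<bullet> w)"
  proof (cases "a\<^sup>2 + b\<^sup>2 = 0")
    case True
    then show ?thesis by simp
  next
    case False
    then have "a\<^sup>2 + b\<^sup>2 > 0"
      by (simp add: less_le)
    with * show ?thesis
      by (simp only: mult_le_cancel_left_pos)
  qed
  then show ?thesis
    unfolding form by (simp add: a_def z_def w_def power_mult_distrib power2_norm_eq_inner)
qed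

lemma heis_norm_triangle: "heis_norm (p \<cdot>\<^sub>H q) \<le> heis_norm p + heis_norm q"
proof -
  define Q :: "'a heis \<Rightarrow> complex" where "Q = (\<lambda>p. Complex ((norm (horiz p))\<^sup>2) (vert p))"
  have Q: "cmod (Q p) = (heis_norm p)\<^sup>2" for p
  proof -
    have "cmod (Q p) = sqrt (heis_norm p ^ 4)"
      by (simp add: Q_def heis_norm_power4 cmod_def)
    also have "heis_norm p ^ 4 = ((heis_norm p)\<^sup>2)\<^sup>2"
      by simp
    finally show ?thesis
      by (simp only: real_sqrt_abs abs_power2)
  qed
  define E where "E = Complex (2 * (horiz p \<bullet> horiz q)) (heis_form p q)"
  have "Q (p \<cdot>\<^sub>H q) = Q p + Q q + E"
    by (simp add: Q_def E_def vert_heis_mult complex_eq_iff power2_norm_eq_inner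
        inner_add_left inner_add_right inner_commute)
  then have "(heis_norm (p \<cdot>\<^sub>H q))\<^sup>2 \<le> (heis_norm p)\<^sup>2 + (heis_norm q)\<^sup>2 + cmod E"
    using norm_triangle_ineq[of "Q p + Q q" E] norm_triangle_ineq[of "Q p" "Q q"]
    unfolding Q[symmetric] by simp
  also have "cmod E \<le> 2 * norm (horiz p) * norm (horiz q)"
    unfolding E_def cmod_def using heis_form_Cauchy_Schwarz[of p q]
    by (intro real_le_lsqrt) simp_all
  also have "\<dots> \<le> 2 * heis_norm p * heis_norm q"
    by (intro mult_mono norm_horiz_le) simp_all
  finally have "(heis_norm (p \<cdot>\<^sub>H q))\<^sup>2 \<le> (heis_norm p + heis_norm q)\<^sup>2"
    by (simp add: power2_sum)
  then show ?thesis
    by (rule power2_le_imp_le) simp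
qed

instantiation heis :: (finite) metric_space
begin

definition dist_heis :: "'a heis \<Rightarrow> 'a heis \<Rightarrow> real" where
  "dist_heis p q = heis_norm (heis_inv p \<cdot>\<^sub>H q)"

definition uniformity_heis :: "('a heis \<times> 'a heis) filter" where
  "uniformity_heis = (INF e\<in>{0<..}. principal {(p, q). dist p q < e})"

definition open_heis :: "'a heis set \<Rightarrow> bool" where
  "open_heis U = (\<forall>p\<in>U. eventually (\<lambda>(p', q). p' = p \<longrightarrow> q \<in> U) uniformity)"

instance
proof
  fix p q s :: "'a heis"
  show "dist p q = 0 \<longleftrightarrow> p = q"
  proof
    assume "dist p q = 0"
    then have "p \<cdot>\<^sub>H (heis_inv p \<cdot>\<^sub>H q) = p"
      by (simp add: dist_heis_def)
    then show "p = q"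
      by (simp flip: heis_mult_assoc)
  qed (simp add: dist_heis_def)
  have "heis_inv p \<cdot>\<^sub>H q = (heis_inv p \<cdot>\<^sub>H s) \<cdot>\<^sub>H heis_inv (heis_inv q \<cdot>\<^sub>H s)"
    by (simp add: heis_inv_mult heis_mult_assoc heis_mult_assoc[of s "heis_inv s", symmetric])
  then show "dist p q \<le> dist p s + dist q s"
    using heis_norm_triangle[of "heis_inv p \<cdot>\<^sub>H s" "heis_inv (heis_inv q \<cdot>\<^sub>H s)"]
    by (simp add: dist_heis_def)
qed (rule uniformity_heis_def open_heis_def)+

end


section \<open>Hausdorff measure\<close>

text \<open>
  A set \<open>E\<close> contributes \<open>(diam E)\<^sup>a\<close>, with the conventions that the empty set contributes \<open>0\<close> and
  that \<open>0\<^sup>0 = 1\<close> (in the library \<open>0 powr 0 = 0\<close>). There is no normalising factor. The covering sets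
  are required to be bounded because \<^const>\<open>diameter\<close> has no meaning for unbounded sets.
\<close>

definition hausdorff_weight :: "real \<Rightarrow> 'a::metric_space set \<Rightarrow> ennreal" where
  "hausdorff_weight a E =
     (if E = {} then 0 else if a = 0 then 1 else ennreal (diameter E powr a))"

definition hausdorff_content :: "real \<Rightarrow> real \<Rightarrow> 'a::metric_space set \<Rightarrow> ennreal" where
  "hausdorff_content a \<delta> A =
     Inf {(\<Sum>i. hausdorff_weight a (E i)) | E :: nat \<Rightarrow> 'a set.
            A \<subseteq> (\<Union>i. E i) \<and> (\<forall>i. bounded (E i) \<and> diameter (E i) \<le> \<delta>)}"

definition hausdorff_measure :: "real \<Rightarrow> 'a::metric_space set \<Rightarrow> ennreal" where
  "hausdorff_measure a A = (SUP \<delta>\<in>{0<..}. hausdorff_content a \<delta> A)"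


section \<open>Self-similar sets\<close>

text \<open>
  By Hutchinson's theorem such a set exists and is unique if the maps are finitely many contractions
  of a complete metric space; otherwise the description below may fail to denote.
\<close>

definition self_similar_set :: "('a::metric_space \<Rightarrow> 'a) set \<Rightarrow> 'a set" where
  "self_similar_set F = (THE K. K \<noteq> {} \<and> compact K \<and> K = (\<Union>f\<in>F. f ` K))"

text \<open>The composition \<open>S\<^bsub>j\<^sub>1\<^esub> \<circ> \<dots> \<circ> S\<^bsub>j\<^sub>k\<^esub>\<close> for the word \<open>[j\<^sub>1, \<dots>, j\<^sub>k]\<close>.\<close>

definition compose_word :: "('i \<Rightarrow> 'a \<Rightarrow> 'a) \<Rightarrow> 'i list \<Rightarrow> 'a \<Rightarrow> 'a" where
  "compose_word S js = foldr (\<lambda>j g. S j \<circ> g) js id"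

definition heis_family :: "real \<Rightarrow> ('n::finite heis \<Rightarrow> 'n heis) set" where
  "heis_family r =
     {heis_translate (Heis z (real k / 4)) \<circ> heis_dilate r | z k.
        (\<forall>i. z $ i \<in> {0, 1 - r}) \<and> k \<in> {0, 1, 2, 3 :: nat}}"

definition heis_K :: "real \<Rightarrow> 'n::finite heis set" where
  "heis_K r = self_similar_set (heis_family r)"

text \<open>Distinct pairs \<open>(z, k)\<close> give distinct maps, so the family has exactly \<open>2\<^sup>2\<^sup>n\<^sup>+\<^sup>2\<close> members.\<close>

lemma card_heis_family:
  assumes "r \<noteq> 1"
  shows "card (heis_family r :: ('n::finite heis \<Rightarrow> 'n heis) set) = 2 ^ (2 * CARD('n) + 2)"
proof -
  define Z where "Z = {z :: real ^ ('n + 'n). \<forall>i. z $ i \<in> {0, 1 - r}}"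
  define f :: "(real ^ ('n + 'n)) \<times> nat \<Rightarrow> 'n heis \<Rightarrow> 'n heis"
    where "f = (\<lambda>(z, k). heis_translate (Heis z (real k / 4)) \<circ> heis_dilate r)"
  have "heis_family r = f ` (Z \<times> {0, 1, 2, 3})"
    unfolding heis_family_def f_def Z_def by (auto simp: image_iff)
  moreover have "inj f"
  proof (rule injI)
    fix x y assume "f x = f y"
    then have "f x heis_one = f y heis_one"
      by simp
    moreover have "f (z, k) heis_one = Heis z (real k / 4)" for z k
      using heis_mult_one(2)[of "Heis z (real k / 4)"]
      by (simp add: f_def heis_translate_def heis_dilate_def heis_one_def)
    ultimately show "x = y"
      by (cases x; cases y) simp
  qed
  moreover have "card Z = 2 ^ (2 * CARD('n))"
  proof -
    have "Z = vec_lambda ` (UNIV \<rightarrow>\<^sub>E {0, 1 - r})"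
      by (force simp: Z_def image_iff intro!: bexI[of _ "\<lambda>i. _ $ i"])
    moreover have "inj (vec_lambda :: ('n + 'n \<Rightarrow> real) \<Rightarrow> _)"
      by (metis injI vec_lambda_inverse UNIV_I)
    ultimately have "card Z = card ((UNIV :: ('n + 'n) set) \<rightarrow>\<^sub>E {0, 1 - r})"
      by (metis card_image inj_on_subset subset_UNIV)
    also have "\<dots> = card {0, 1 - r} ^ CARD('n + 'n)"
      by (subst card_PiE) simp_all
    also have "card {0, 1 - r} = 2"
      using assms by simp
    finally show ?thesis
      by (simp only: card_sum mult_2)
  qed
  moreover have "card {0, 1, 2, 3 :: nat} = 2 ^ 2"
    by simp
  ultimately show ?thesis
    by (metis card_image inj_on_subset subset_UNIV card_cartesian_product power_add)
qed

end

theory Submission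
  imports Defs
begin

text \<open>
  The horizontal part of \<open>K\<^sub>r\<close> is a product of Cantor sets in which the first digit of a point is
  determined by the point, because \<open>r < 1/2\<close>. Two points of \<open>K\<^sub>r\<close> on the same vertical fibre
  therefore have the same horizontal digits, and the largest height difference \<open>D\<close> on a fibre
  satisfies \<open>D \<le> 3/4 + r\<^sup>2 D\<close>, so \<open>D \<le> 1\<close>. On a fibre, two pieces are shifted against each other
  by at least \<open>1/4 > r\<^sup>2 D\<close>, so they are disjoint.

  By compactness the pieces are then at a positive distance, and a set of diameter below
  \<open>e r\<^sup>m\<close> meets at most one of the \<open>N\<^sup>m\<close> pieces of level \<open>m\<close>. Since pieces are relatively open,
  any cover of \<open>K\<^sub>r\<close> by sets of small diameter can be replaced by a finite cover by pieces, and
  counting subpieces of a common level gives the weight \<open>\<Sum> N\<^bsup>-m\<^esup>\<close> of such a cover as at least \<open>1\<close>;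
  here \<open>N\<^bsup>-m\<^esup> = (r\<^sup>m)\<^sup>a\<close>.
\<close>

section \<open>Contractions of a proper metric space\<close>

text \<open>The finite supremum \<open>D\<close> of \<open>f\<close> satisfies
  \<open>D <= c + s * D\<close>, which can be solved for \<open>D\<close> because
  \<open>s < 1\<close>. Self-similarity supplies \<open>step\<close> wherever a quantity at a point
  is controlled by the same quantity at a preimage.\<close>

lemma self_improving_bound:
  fixes f :: "'a \<Rightarrow> real"
  assumes bdd: "bdd_above (f ` X)" and s: "0 \<le> s" "s < 1"
    and step: "\<And>x. x \<in> X \<Longrightarrow> \<exists>y\<in>X. f x \<le> c + s * f y"
    and x: "x \<in> X"
  shows "f x \<le> c / (1 - s)"
proof -
  define D where "D = (SUP x\<in>X. f x)"
  have upper: "f y \<le> D" if "y \<in> X" for y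
    unfolding D_def using that bdd by (rule cSUP_upper)
  have "D \<le> c + s * D"
    unfolding D_def
  proof (rule cSUP_least)
    show "X \<noteq> {}" using x by auto
    fix y assume "y \<in> X"
    then obtain z where "z \<in> X" and z: "f y \<le> c + s * f z" using step by blast
    have "s * f z \<le> s * D" using upper[OF \<open>z \<in> X\<close>] s by (intro mult_left_mono)
    with z show "f y \<le> c + s * (SUP x\<in>X. f x)" by (simp add: D_def)
  qed
  then have "D \<le> c / (1 - s)"
    using s by (simp add: field_simps)
  with upper[OF x] show ?thesis by simp
qed

text \<open>The distance to \<open>B\<close> contracts: a point \<open>f z\<close> of
  \<open>A\<close> is at most \<open>r * infdist z B\<close> away from the image of \<open>B\<close>
  under \<open>f\<close>, which lies in \<open>B\<close>. The self-improving bound with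
  \<open>c = 0\<close> then gives distance 0. Used in both directions, this yields uniqueness of the
  attractor.\<close>

lemma contractions_fixed_set_subset:
  fixes F :: "('a::metric_space \<Rightarrow> 'a) set"
  assumes contr: "\<And>f x y. f \<in> F \<Longrightarrow> dist (f x) (f y) \<le> r * dist x y" and r: "0 \<le> r" "r < 1"
    and A: "bounded A" "A \<subseteq> (\<Union>f\<in>F. f ` A)"
    and B: "closed B" "B \<noteq> {}" "(\<Union>f\<in>F. f ` B) \<subseteq> B"
  shows "A \<subseteq> B"
proof
  fix x assume x: "x \<in> A"
  have "infdist x B \<le> 0 / (1 - r)"
  proof (rule self_improving_bound[OF _ r _ x])
    obtain b where b: "b \<in> B" using B by blast
    obtain M where "\<And>y. y \<in> A \<Longrightarrow> dist b y \<le> M"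
      using A(1) bounded_any_center[of A b] by auto
    then show "bdd_above ((\<lambda>y. infdist y B) ` A)"
      using infdist_le[OF b] by (intro bdd_aboveI2[of _ _ M]) (metis dist_commute order_trans)
    fix y assume "y \<in> A"
    then obtain f z where f: "f \<in> F" and z: "z \<in> A" "y = f z"
      using A(2) by blast
    have "infdist y B \<le> r * dist z w" if "w \<in> B" for w
    proof -
      have "f w \<in> B" using B(3) f that by blast
      then have "infdist y B \<le> dist y (f w)" by (rule infdist_le)
      also have "\<dots> \<le> r * dist z w" using contr[OF f] z by simp
      finally show ?thesis .
    qed
    then have "infdist y B \<le> (INF w\<in>B. r * dist z w)"
      using B(2) by (intro cINF_greatest) auto
    \<comment> \<open>Multiplication by \<open>r\<close> is monotone and continuous, so it commutes
      with the infimum, also for \<open>r = 0\<close>.\<close>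
    also have "\<dots> = r * (INF w\<in>B. dist z w)"
      using B(2) r(1)
      by (intro continuous_at_Inf_mono[where f="\<lambda>x. r * x" and S="dist z ` B", symmetric,
            unfolded image_image])
        (auto intro!: monoI mult_left_mono continuous_intros bdd_belowI2[of _ 0])
    also have "\<dots> = r * infdist z B"
      using B(2) by (simp add: infdist_def)
    finally show "\<exists>z\<in>A. infdist y B \<le> 0 + r * infdist z B"
      using z by auto
  qed
  then have "infdist x B = 0"
    using infdist_nonneg[of x B] by simp
  then show "x \<in> B"
    using in_closed_iff_infdist_zero[OF B(1,2)] by simp
qed

text \<open>Compactness of closed balls allows a direct construction: iterating the set map
  \<open>H\<close> on an invariant ball gives a decreasing sequence of nonempty compact sets, and
  the attractor is their intersection.\<close>

theorem Hutchinson: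
  fixes F :: "('a::heine_borel \<Rightarrow> 'a) set"
  assumes F: "finite F" "F \<noteq> {}"
    and contr: "\<And>f x y. f \<in> F \<Longrightarrow> dist (f x) (f y) \<le> r * dist x y" and r: "0 \<le> r" "r < 1"
  shows "\<exists>!K. K \<noteq> {} \<and> compact K \<and> K = (\<Union>f\<in>F. f ` K)"
proof (rule ex_ex1I)
  define H where "H A = (\<Union>f\<in>F. f ` A)" for A
  have cont: "continuous_on UNIV f" if "f \<in> F" for f
    using contr[OF that] r(1) by (intro lipschitz_on_continuous_on[of r] lipschitz_onI) auto
  have H_mono: "H A \<subseteq> H B" if "A \<subseteq> B" for A B
    using that by (auto simp: H_def)
  define x0 :: 'a where "x0 = undefined"
  define M where "M = Max ((\<lambda>f. dist x0 (f x0)) ` F)"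
  have M: "dist x0 (f x0) \<le> M" if "f \<in> F" for f
    unfolding M_def using that F by (intro Max_ge) auto
  have M0: "0 \<le> M"
    using M F(2) by (meson all_not_in_conv order_trans zero_le_dist)
  \<comment> \<open>The radius solves \<open>R = M + r * R\<close>, where \<open>M\<close> bounds
    the displacement of the centre, so every map sends the ball into itself.\<close>
  define B where "B = cball x0 (M / (1 - r))"
  have "f y \<in> B" if f: "f \<in> F" and y: "y \<in> B" for f y
  proof -
    have "dist x0 (f y) \<le> dist x0 (f x0) + dist (f x0) (f y)"
      by (rule dist_triangle)
    also have "\<dots> \<le> M + r * (M / (1 - r))"
      using M[OF f] contr[OF f, of x0 y] y r mult_left_mono[of "dist x0 y" "M / (1 - r)" r]
      by (simp add: B_def)
    also have "\<dots> = M / (1 - r)"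
      using r by (simp add: field_simps)
    finally show ?thesis by (simp add: B_def)
  qed
  then have HB: "H B \<subseteq> B" by (auto simp: H_def)
  define C where "C k = (H ^^ k) B" for k
  have C_Suc: "C (Suc k) = H (C k)" for k by (simp add: C_def)
  have C_compact: "compact (C k)" for k
  proof (induction k)
    case 0 show ?case by (simp add: C_def B_def)
  next
    case (Suc k)
    then show ?case unfolding C_Suc H_def using F(1)
      by (intro compact_UN compact_continuous_image) (auto intro: continuous_on_subset[OF cont])
  qed
  have C_ne: "C k \<noteq> {}" for k
  proof (induction k)
    case 0
    have "x0 \<in> B" using M0 r by (simp add: B_def)
    then show ?case by (auto simp: C_def)
  next
    case (Suc k) then show ?case using F(2) by (auto simp: C_Suc H_def)
  qed
  have C_Suc_le: "C (Suc k) \<subseteq> C k" for k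
  proof (induction k)
    case 0 show ?case using HB by (simp add: C_def)
  next
    case (Suc k) then show ?case by (subst (1 2) C_Suc) (rule H_mono)
  qed
  have C_anti: "C n \<subseteq> C m" if "m \<le> n" for m n
    using C_Suc_le that by (rule lift_Suc_antimono_le)
  define K where "K = (\<Inter>k. C k)"
  have "K \<noteq> {}"
    unfolding K_def by (rule compact_nest[OF C_compact C_ne C_anti])
  moreover have "compact K"
    unfolding K_def using C_compact compact_imp_closed by (intro compact_Inter) auto
  moreover have "H K \<subseteq> K"
  proof -
    have "H K \<subseteq> C k" for k
      using H_mono[of K "C k"] C_Suc_le[of k] by (force simp: C_Suc K_def)
    then show ?thesis by (auto simp: K_def)
  qed
  moreover have "K \<subseteq> H K"
  proof
    fix x assume x: "x \<in> K"
    \<comment> \<open>One map must serve all levels: if each \<open>f\<close> failed at some level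
      \<open>k f\<close>, then by monotonicity all would fail at the maximum of these finitely many
      levels.\<close>
    have "\<exists>f\<in>F. \<forall>k. x \<in> f ` C k"
    proof (rule ccontr)
      assume "\<not> (\<exists>f\<in>F. \<forall>k. x \<in> f ` C k)"
      then obtain k where k: "\<And>f. f \<in> F \<Longrightarrow> x \<notin> f ` C (k f)" by metis
      have "x \<in> C (Suc (Max (k ` F)))" using x by (auto simp: K_def)
      then obtain f where f: "f \<in> F" "x \<in> f ` C (Max (k ` F))" by (auto simp: C_Suc H_def)
      have "C (Max (k ` F)) \<subseteq> C (k f)" using f F by (intro C_anti Max_ge) auto
      with f k[OF f(1)] show False by blast
    qed
    then obtain f where f: "f \<in> F" "\<And>k. x \<in> f ` C k" by blast
    \<comment> \<open>The preimages of \<open>x\<close> in the sets \<open>C k\<close> are nested,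
      nonempty and compact, so a single preimage lies in every \<open>C k\<close>.\<close>
    have "(\<Inter>k. C k \<inter> f -` {x}) \<noteq> {}"
    proof (rule compact_nest)
      show "compact (C k \<inter> f -` {x})" for k
        using closed_vimage[OF closed_singleton cont[OF f(1)]] C_compact by (intro compact_Int_closed)
      show "C k \<inter> f -` {x} \<noteq> {}" for k using f(2)[of k] by auto
      show "C n \<inter> f -` {x} \<subseteq> C m \<inter> f -` {x}" if "m \<le> n" for m n using C_anti[OF that] by auto
    qed
    then obtain y where "y \<in> K" "f y = x" by (auto simp: K_def)
    then show "x \<in> H K" using f(1) by (auto simp: H_def)
  qed
  ultimately show "\<exists>K. K \<noteq> {} \<and> compact K \<and> K = (\<Union>f\<in>F. f ` K)"
    by (intro exI[of _ K]) (auto simp: H_def)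
next
  fix K L assume *: "K \<noteq> {} \<and> compact K \<and> K = (\<Union>f\<in>F. f ` K)"
    "L \<noteq> {} \<and> compact L \<and> L = (\<Union>f\<in>F. f ` L)"
  have sub: "A \<subseteq> B" if A: "A \<noteq> {} \<and> compact A \<and> A = (\<Union>f\<in>F. f ` A)"
    and B: "B \<noteq> {} \<and> compact B \<and> B = (\<Union>f\<in>F. f ` B)" for A B
  proof (rule contractions_fixed_set_subset[OF contr r])
    show "bounded A" "closed B" using A B by (blast intro: compact_imp_bounded compact_imp_closed)+
    show "A \<subseteq> (\<Union>f\<in>F. f ` A)" "B \<noteq> {}" "(\<Union>f\<in>F. f ` B) \<subseteq> B" using A B by blast+
  qed
  show "K = L"
    using sub[OF *] sub[OF *(2,1)] by (rule equalityI)
qed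

section \<open>Self-similar sets with disjoint pieces of equal ratio\<close>

text \<open>The common ratio makes the scale of a cylinder depend on its level alone, so that covers
  can be compared by counting words.\<close>

locale separated_similarities =
  fixes S :: "'i \<Rightarrow> 'a::metric_space \<Rightarrow> 'a" and I :: "'i set" and K :: "'a set" and r :: real
  assumes finite_I: "finite I"
    and r: "0 < r" "r < 1"
    and dist_S: "\<And>i x y. i \<in> I \<Longrightarrow> dist (S i x) (S i y) = r * dist x y"
    and compact_K: "compact K" and K_ne: "K \<noteq> {}"
    and K_eq: "K = (\<Union>i\<in>I. S i ` K)"
    and disjoint: "disjoint_family_on (\<lambda>i. S i ` K) I"
begin

section \<open>Words and cylinder sets\<close>

abbreviation words :: "nat \<Rightarrow> 'i list set" where
  "words k \<equiv> {js. length js = k \<and> set js \<subseteq> I}"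

abbreviation cylinder :: "'i list \<Rightarrow> 'a set" where
  "cylinder js \<equiv> compose_word S js ` K"

lemma compose_word_simps [simp]:
  "compose_word S [] = id" "compose_word S (i # js) = S i \<circ> compose_word S js"
  by (simp_all add: compose_word_def)

lemma compose_word_append: "compose_word S (u @ v) = compose_word S u \<circ> compose_word S v"
  by (induction u) (simp_all add: comp_assoc)

lemma dist_compose_word:
  "set js \<subseteq> I \<Longrightarrow> dist (compose_word S js x) (compose_word S js y) = r ^ length js * dist x y"
  by (induction js) (simp_all add: dist_S)

lemma finite_words: "finite (words k)" and card_words: "card (words k) = card I ^ k"
  using finite_lists_length_eq[OF finite_I, of k] card_lists_length_eq[OF finite_I, of k]
  by (simp_all add: conj_commute)

lemma card_I_pos: "0 < card I"
proof -
  have "I \<noteq> {}" using K_ne K_eq by (metis UN_empty)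
  then show ?thesis using finite_I by (simp add: card_gt_0_iff)
qed

text \<open>The fixed-point equation unrolled \<open>k\<close> times, splitting off the outermost
  map.\<close>

lemma K_eq_cylinders: "K = (\<Union>js\<in>words k. cylinder js)"
proof (induction k)
  case 0
  then show ?case by auto
next
  case (Suc k)
  have "words (Suc k) = (\<Union>i\<in>I. (#) i ` words k)"
    by (auto simp: length_Suc_conv)
  then have "(\<Union>js\<in>words (Suc k). cylinder js) = (\<Union>i\<in>I. \<Union>js\<in>words k. cylinder (i # js))"
    by (simp only: UN_UN_flatten image_image UN_simps)
  also have "\<dots> = (\<Union>i\<in>I. S i ` (\<Union>js\<in>words k. cylinder js))"
    by (simp only: image_UN compose_word_simps image_comp)
  also have "\<dots> = K"
    by (simp only: Suc[symmetric] K_eq[symmetric])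
  finally show ?case by simp
qed

lemma cylinder_subset: "set js \<subseteq> I \<Longrightarrow> cylinder js \<subseteq> K"
  using K_eq_cylinders[of "length js"] by blast

lemma cylinder_eq_refinement: "cylinder u = (\<Union>v\<in>words k. cylinder (u @ v))"
  by (subst K_eq_cylinders[of k]) (simp add: image_UN image_comp compose_word_append)

lemma compact_cylinder:
  assumes "set js \<subseteq> I"
  shows "compact (cylinder js)"
proof (rule compact_continuous_image[OF _ compact_K])
  show "continuous_on K (compose_word S js)"
    using dist_compose_word[OF assms] r
    by (intro lipschitz_on_continuous_on[of "r ^ length js"] lipschitz_onI) auto
qed

section \<open>Separation of cylinders of the same level\<close>

text \<open>Two disjoint compact sets attain a positive minimal distance on their product, and there
  are finitely many pairs.\<close>

lemma pieces_apart:
  "\<exists>e>0. \<forall>i\<in>I. \<forall>j\<in>I. i \<noteq> j \<longrightarrow> (\<forall>x\<in>S i ` K. \<forall>y\<in>S j ` K. e \<le> dist x y)"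
proof -
  define P where "P = {(i, j) \<in> I \<times> I. i \<noteq> j}"
  have fin: "finite P" unfolding P_def using finite_I by (auto intro: finite_subset[of _ "I \<times> I"])
  have "\<exists>d>0. \<forall>x\<in>S i ` K. \<forall>y\<in>S j ` K. d \<le> dist x y" if "(i, j) \<in> P" for i j
  proof -
    have "compact (S i ` K \<times> S j ` K)"
      using compact_cylinder[of "[i]"] compact_cylinder[of "[j]"] that
      by (intro compact_Times) (auto simp: P_def)
    moreover have "S i ` K \<times> S j ` K \<noteq> {}" using K_ne by simp
    moreover have "continuous_on (S i ` K \<times> S j ` K) (\<lambda>q. dist (fst q) (snd q))"
      by (intro continuous_intros)
    ultimately have "\<exists>p\<in>S i ` K \<times> S j ` K. \<forall>q\<in>S i ` K \<times> S j ` K.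
        dist (fst p) (snd p) \<le> dist (fst q) (snd q)"
      by (rule continuous_attains_inf)
    then obtain p where p: "p \<in> S i ` K \<times> S j ` K"
      "\<forall>q\<in>S i ` K \<times> S j ` K. dist (fst p) (snd p) \<le> dist (fst q) (snd q)"
      by (elim bexE)
    have "S i ` K \<inter> S j ` K = {}"
      using disjoint that by (auto simp: P_def disjoint_family_on_def)
    then have "fst p \<noteq> snd p"
      using p(1) by (metis disjoint_iff mem_Times_iff)
    with p(2) show ?thesis
      by (intro exI[of _ "dist (fst p) (snd p)"]) auto
  qed
  then have "\<forall>p\<in>P. \<exists>d>0. \<forall>x\<in>S (fst p) ` K. \<forall>y\<in>S (snd p) ` K. d \<le> dist x y" by simp
  then have "\<exists>d. \<forall>p\<in>P. d p > 0 \<and> (\<forall>x\<in>S (fst p) ` K. \<forall>y\<in>S (snd p) ` K. d p \<le> dist x y)"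
    by (rule bchoice)
  then obtain d where d: "\<forall>p\<in>P. d p > 0 \<and> (\<forall>x\<in>S (fst p) ` K. \<forall>y\<in>S (snd p) ` K. d p \<le> dist x y)"
    by blast
  \<comment> \<open>Inserting 1 keeps the minimum defined when there is a single map and
    \<open>P\<close> is empty.\<close>
  show ?thesis
  proof (intro exI[of _ "Min (insert 1 (d ` P))"] conjI ballI impI)
    show "0 < Min (insert 1 (d ` P))" using fin d by auto
    fix i j x y assume *: "i \<in> I" "j \<in> I" "i \<noteq> j" "x \<in> S i ` K" "y \<in> S j ` K"
    then have P: "(i, j) \<in> P" by (simp add: P_def)
    then have "Min (insert 1 (d ` P)) \<le> d (i, j)" using fin by (intro Min_le) auto
    also have "\<forall>x\<in>S i ` K. \<forall>y\<in>S j ` K. d (i, j) \<le> dist x y"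
      using bspec[OF d P] unfolding fst_conv snd_conv by (rule conjunct2)
    then have "d (i, j) \<le> dist x y" using *(4,5) by blast
    finally show "Min (insert 1 (d ` P)) \<le> dist x y" .
  qed
qed

text \<open>Equal first letters are stripped off, which scales distances by \<open>r\<close>;
  different first letters put the points in different first-level pieces, at distance at least
  \<open>e\<close>.\<close>

lemma cylinders_apart:
  "\<exists>e>0. \<forall>k. \<forall>u\<in>words k. \<forall>v\<in>words k. u \<noteq> v \<longrightarrow>
     (\<forall>x\<in>cylinder u. \<forall>y\<in>cylinder v. e * r ^ k \<le> dist x y)"
proof -
  obtain e where e: "0 < e"
    and sep: "\<forall>i\<in>I. \<forall>j\<in>I. i \<noteq> j \<longrightarrow> (\<forall>x\<in>S i ` K. \<forall>y\<in>S j ` K. e \<le> dist x y)"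
    using pieces_apart by blast
  have "e * r ^ k \<le> dist x y"
    if "u \<in> words k" "v \<in> words k" "u \<noteq> v" "x \<in> cylinder u" "y \<in> cylinder v" for k u v x y
    using that
  proof (induction k arbitrary: u v x y)
    case 0
    then show ?case by simp
  next
    case (Suc k)
    obtain i u' j v' where uv: "u = i # u'" "v = j # v'" and I: "i \<in> I" "j \<in> I"
      and w: "u' \<in> words k" "v' \<in> words k"
      using Suc.prems(1,2) by (auto simp: length_Suc_conv)
    obtain x' y' where xy: "x = S i x'" "y = S j y'" "x' \<in> cylinder u'" "y' \<in> cylinder v'"
      using Suc.prems(4,5) uv by auto
    show ?case
    proof (cases "i = j")
      case True
      then have "e * r ^ k \<le> dist x' y'" using Suc.IH[OF w _ xy(3,4)] uv Suc.prems(3) by simp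
      then show ?thesis using True xy dist_S[OF I(2)] r by simp
    next
      case False
      have "x \<in> S i ` K" "y \<in> S j ` K"
        using xy w cylinder_subset by blast+
      then have "e \<le> dist x y" using sep I False by blast
      moreover have "e * r ^ Suc k \<le> e * 1"
        using e r by (intro mult_left_mono power_le_one) auto
      ultimately show ?thesis by simp
    qed
  qed
  with e show ?thesis by blast
qed

lemma cylinders_disjoint:
  assumes "u \<in> words k" "v \<in> words k" "u \<noteq> v"
  shows "cylinder u \<inter> cylinder v = {}"
proof -
  obtain e where e: "0 < e" and apart: "\<forall>k. \<forall>u\<in>words k. \<forall>v\<in>words k. u \<noteq> v \<longrightarrow>
      (\<forall>x\<in>cylinder u. \<forall>y\<in>cylinder v. e * r ^ k \<le> dist x y)"
    using cylinders_apart by blast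
  have False if "x \<in> cylinder u" "x \<in> cylinder v" for x
  proof -
    have "e * r ^ k \<le> dist x x" using apart assms that by blast
    moreover have "0 < e * r ^ k" using e r by simp
    ultimately show False by simp
  qed
  then show ?thesis by blast
qed

text \<open>Within \<open>K\<close>, a cylinder is the complement of the finitely many other closed
  cylinders of its level. This lets compactness act on covers by cylinders.\<close>

lemma cylinder_relatively_open:
  assumes "set u \<subseteq> I"
  shows "\<exists>U. open U \<and> K \<inter> U = cylinder u"
proof (intro exI conjI)
  let ?V = "words (length u) - {u}"
  show "open (- (\<Union>v\<in>?V. cylinder v))"
    using finite_words by (intro open_Compl closed_UN) (auto intro: compact_imp_closed compact_cylinder)
  show "K \<inter> - (\<Union>v\<in>?V. cylinder v) = cylinder u"
  proof (intro equalityI subsetI)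
    fix x assume x: "x \<in> K \<inter> - (\<Union>v\<in>?V. cylinder v)"
    then have "x \<in> K" by blast
    then obtain v where "v \<in> words (length u)" "x \<in> cylinder v"
      using K_eq_cylinders[of "length u"] by blast
    with x show "x \<in> cylinder u" by (cases "v = u") auto
  next
    fix x assume x: "x \<in> cylinder u"
    then have "x \<notin> cylinder v" if "v \<in> ?V" for v
      using cylinders_disjoint[of u "length u" v] that assms by auto
    with x cylinder_subset[OF assms] show "x \<in> K \<inter> - (\<Union>v\<in>?V. cylinder v)" by blast
  qed
qed

section \<open>Counting covers by cylinders\<close>

text \<open>Refine to a common level \<open>L\<close>. Cylinders of level \<open>L\<close> are
  pairwise disjoint and nonempty, so every word of length \<open>L\<close> must extend some
  \<open>w t\<close>; each \<open>w t\<close> has only \<open>card I ^ (L - length (w t))\<close>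
  such extensions.\<close>

lemma cylinder_cover_weight:
  assumes T: "finite T" and w: "\<And>t. t \<in> T \<Longrightarrow> set (w t) \<subseteq> I"
    and cover: "K \<subseteq> (\<Union>t\<in>T. cylinder (w t))"
  shows "1 \<le> (\<Sum>t\<in>T. 1 / real (card I) ^ length (w t))"
proof -
  define L where "L = Max ((\<lambda>t. length (w t)) ` T)"
  have L: "length (w t) \<le> L" if "t \<in> T" for t
    unfolding L_def using that T by (intro Max_ge) auto
  have "words L \<subseteq> (\<Union>t\<in>T. (@) (w t) ` words (L - length (w t)))"
  proof
    fix u assume u: "u \<in> words L"
    obtain x where x: "x \<in> cylinder u" using K_ne by blast
    then have "x \<in> K" using cylinder_subset u by blast
    then obtain t where t: "t \<in> T" "x \<in> cylinder (w t)" using cover by blast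
    then obtain v where v: "v \<in> words (L - length (w t))" "x \<in> cylinder (w t @ v)"
      using cylinder_eq_refinement[of "w t" "L - length (w t)"] by blast
    have "w t @ v \<in> words L" using v w[OF t(1)] L[OF t(1)] by auto
    then have "u = w t @ v" using cylinders_disjoint[OF u] x v(2) by blast
    with v(1) t(1) show "u \<in> (\<Union>t\<in>T. (@) (w t) ` words (L - length (w t)))" by blast
  qed
  then have "card (words L) \<le> card (\<Union>t\<in>T. (@) (w t) ` words (L - length (w t)))"
    using T finite_words by (intro card_mono) auto
  also have "\<dots> \<le> (\<Sum>t\<in>T. card ((@) (w t) ` words (L - length (w t))))"
    using T by (rule card_UN_le)
  also have "\<dots> = (\<Sum>t\<in>T. card I ^ (L - length (w t)))"
  proof (rule sum.cong[OF refl])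
    fix t
    have "inj_on ((@) (w t)) (words (L - length (w t)))" by (simp add: inj_on_def)
    then show "card ((@) (w t) ` words (L - length (w t))) = card I ^ (L - length (w t))"
      by (simp only: card_image card_words)
  qed
  finally have "real (card I ^ L) \<le> real (\<Sum>t\<in>T. card I ^ (L - length (w t)))"
    by (simp only: card_words of_nat_le_iff)
  also have "\<dots> = (\<Sum>t\<in>T. real (card I) ^ L * (1 / real (card I) ^ length (w t)))"
    unfolding of_nat_sum of_nat_power using card_I_pos L
    by (intro sum.cong refl) (simp add: power_diff)
  also have "\<dots> = real (card I) ^ L * (\<Sum>t\<in>T. 1 / real (card I) ^ length (w t))"
    by (simp add: sum_distrib_left)
  finally show ?thesis using card_I_pos by simp
qed

text \<open>The assumption is the equation of the similarity dimension; it turns the combinatorial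
  weight of a word into the power of its scale.\<close>

lemma card_I_inverse_power:
  assumes "real (card I) * r powr a = 1"
  shows "1 / real (card I) ^ k = (r ^ k) powr a"
proof -
  have "1 / real (card I) ^ k = (r powr a) ^ k"
    using assms card_I_pos by (simp add: field_simps flip: power_mult_distrib)
  also have "\<dots> = (r ^ k) powr a"
    using r by (simp add: powr_power powr_powr mult.commute flip: powr_realpow)
  finally show ?thesis .
qed

section \<open>Lower and upper bounds for the Hausdorff measure\<close>

lemma hausdorff_measure_pos:
  assumes a: "0 < a" and dim: "real (card I) * r powr a = 1"
  shows "0 < hausdorff_measure a K"
proof -
  obtain e where e: "0 < e"
    and apart: "\<forall>k. \<forall>u\<in>words k. \<forall>v\<in>words k. u \<noteq> v \<longrightarrow>
      (\<forall>x\<in>cylinder u. \<forall>y\<in>cylinder v. e * r ^ k \<le> dist x y)"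
    using cylinders_apart by blast
  \<comment> \<open>If \<open>m\<close> is the last level with
    \<open>diameter E < e * r ^ m\<close>, then \<open>e * r ^ Suc m <= diameter E\<close>, hence
    \<open>r ^ m <= diameter E / (r * e)\<close>; \<open>c\<close> is the resulting
    constant.\<close>
  define c where "c = (r * e) powr a"
  have c: "0 < c" using r e by (simp add: c_def)
  have small_in_cylinder: "\<exists>w. set w \<subseteq> I \<and> E \<inter> K \<subseteq> cylinder w \<and>
      1 / real (card I) ^ length w \<le> diameter E powr a / c + h"
    if E: "bounded E" "diameter E < e" and h: "0 < h" for E h
  proof -
    have "\<exists>m. diameter E < e * r ^ m \<and> (r ^ m) powr a \<le> diameter E powr a / c + h"
    proof (cases "diameter E = 0")
      case True
      \<comment> \<open>At diameter 0 there is no last level, and \<open>m\<close> is taken so large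
        that the weight is below \<open>h\<close>.\<close>
      have "r powr a < 1" using powr_less_mono2[of a r 1] r a by simp
      then obtain m where "(r powr a) ^ m < h"
        using h real_arch_pow_inv by blast
      moreover have "(r powr a) ^ m = (r ^ m) powr a"
        using r by (simp add: powr_power powr_powr mult.commute flip: powr_realpow)
      ultimately show ?thesis using True e r a by (intro exI[of _ m]) auto
    next
      case False
      then have d: "0 < diameter E" using diameter_ge_0[OF E(1)] by simp
      obtain n where n: "r ^ n < diameter E / e"
        using d e r by (meson divide_pos_pos real_arch_pow_inv)
      \<comment> \<open>The first level that fails. Level 0 does not fail since
        \<open>diameter E < e\<close>, so \<open>l\<close> has a predecessor, the last good
        level.\<close>
      define l where "l = (LEAST n. e * r ^ n \<le> diameter E)"
      have l: "e * r ^ l \<le> diameter E"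
        unfolding l_def by (rule LeastI[of _ n]) (use n e in \<open>simp add: field_simps\<close>)
      then have "l \<noteq> 0" using E(2) by (intro notI) simp
      then obtain m where m: "l = Suc m" using not0_implies_Suc by blast
      then have "\<not> e * r ^ m \<le> diameter E"
        unfolding l_def using not_less_Least[of m "\<lambda>n. e * r ^ n \<le> diameter E"] by simp
      moreover have "(r ^ m) powr a \<le> (diameter E / (r * e)) powr a"
        using l e r a m by (intro powr_mono2) (auto simp: field_simps)
      then have "(r ^ m) powr a \<le> diameter E powr a / c"
        using d r e by (simp add: c_def powr_divide)
      ultimately show ?thesis using h by (intro exI[of _ m]) auto
    qed
    then obtain m where m: "diameter E < e * r ^ m"
      and m_le: "(r ^ m) powr a \<le> diameter E powr a / c + h" by blast
    \<comment> \<open>If \<open>E\<close> misses \<open>K\<close>, any word serves. Otherwise take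
      the cylinder of one point: a second point in another cylinder would be farther away than
      \<open>diameter E\<close>.\<close>
    have "\<exists>w\<in>words m. E \<inter> K \<subseteq> cylinder w"
    proof (cases "E \<inter> K = {}")
      case True
      then show ?thesis using card_words[of m] card_I_pos
        by (metis (no_types, lifting) all_not_in_conv card.empty empty_subsetI nat_neq_iff zero_less_power)
    next
      case False
      then obtain x where x: "x \<in> E" "x \<in> K" by blast
      then obtain w where w: "w \<in> words m" "x \<in> cylinder w" using K_eq_cylinders[of m] by blast
      have "y \<in> cylinder w" if y: "y \<in> E" "y \<in> K" for y
      proof (rule ccontr)
        assume "y \<notin> cylinder w"
        moreover obtain v where v: "v \<in> words m" "y \<in> cylinder v"
          using y K_eq_cylinders[of m] by blast
        ultimately have "w \<noteq> v" by blast
        then have "e * r ^ m \<le> dist x y" using apart w v by blast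
        then show False
          using diameter_bounded_bound[OF E(1) x(1) y(1)] m by simp
      qed
      with w show ?thesis by blast
    qed
    then show ?thesis using card_I_inverse_power[OF dim, of m] m_le by fastforce
  qed
  \<comment> \<open>One scale suffices, since the measure is a supremum over scales. The choice
    \<open>e / 2\<close> turns the non-strict bound on diameters into a strict bound by
    \<open>e\<close>.\<close>
  have "ennreal (c / 2) \<le> hausdorff_content a (e / 2) K"
    unfolding hausdorff_content_def
  proof (rule Inf_greatest, clarify)
    fix E :: "nat \<Rightarrow> 'a set"
    assume cover: "K \<subseteq> (\<Union>i. E i)" and E: "\<forall>i. bounded (E i) \<and> diameter (E i) \<le> e / 2"
    \<comment> \<open>The error term handles covering sets of diameter \<open>0\<close>, which lie in pieces of every level.\<close>
    have "\<exists>w. set w \<subseteq> I \<and> E i \<inter> K \<subseteq> cylinder w \<and>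
      1 / real (card I) ^ length w \<le> diameter (E i) powr a / c + (1 / 2) ^ Suc (Suc i)" for i
    proof (rule small_in_cylinder)
      show "bounded (E i)" using E by simp
      show "diameter (E i) < e" using E e by (smt (verit) field_sum_of_halves)
    qed simp
    then obtain w where w: "\<And>i. set (w i) \<subseteq> I" "\<And>i. E i \<inter> K \<subseteq> cylinder (w i)"
      and w_le: "\<And>i. 1 / real (card I) ^ length (w i) \<le> diameter (E i) powr a / c + (1 / 2) ^ Suc (Suc i)"
      by metis
    obtain U where U: "\<And>i. open (U i)" "\<And>i. K \<inter> U i = cylinder (w i)"
      using cylinder_relatively_open[OF w(1)] by metis
    \<comment> \<open>Only nonempty covering sets are kept, so that \<open>hausdorff_weight\<close>
      unfolds to the power of the diameter below.\<close>
    have "K \<subseteq> (\<Union>i\<in>{i. E i \<noteq> {}}. U i)"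
    proof
      fix x assume x: "x \<in> K"
      then obtain i where "x \<in> E i" using cover by blast
      then show "x \<in> (\<Union>i\<in>{i. E i \<noteq> {}}. U i)" using w(2)[of i] U(2)[of i] x by blast
    qed
    then obtain T where T: "T \<subseteq> {i. E i \<noteq> {}}" "finite T" "K \<subseteq> (\<Union>i\<in>T. U i)"
      using compactE_image[OF compact_K, of "{i. E i \<noteq> {}}" U] U(1) by metis
    then have "K \<subseteq> (\<Union>i\<in>T. cylinder (w i))" using U(2) by blast
    then have "1 \<le> (\<Sum>i\<in>T. 1 / real (card I) ^ length (w i))"
      using T(2) w(1) by (intro cylinder_cover_weight) auto
    also have "\<dots> \<le> (\<Sum>i\<in>T. diameter (E i) powr a / c + (1 / 2) ^ Suc (Suc i))"
      by (intro sum_mono w_le)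
    also have "\<dots> = (\<Sum>i\<in>T. diameter (E i) powr a) / c + (\<Sum>i\<in>T. (1 / 2) ^ Suc i) / 2"
      by (simp add: sum.distrib sum_divide_distrib)
    \<comment> \<open>The errors \<open>(1 / 2) ^ (i + 2)\<close> add up to at most 1/2, so half of
      the unit weight remains; this is the origin of \<open>c / 2\<close>.\<close>
    also have "\<dots> \<le> (\<Sum>i\<in>T. diameter (E i) powr a) / c + 1 / 2"
      using sum_le_suminf[of "\<lambda>i. (1 / 2 :: real) ^ Suc i" T] T(2) power_half_series
      by (simp add: sums_iff)
    finally have "c / 2 \<le> (\<Sum>i\<in>T. diameter (E i) powr a)"
      using c by (simp add: field_simps)
    then have "ennreal (c / 2) \<le> (\<Sum>i\<in>T. ennreal (diameter (E i) powr a))"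
      by (simp add: ennreal_leI)
    also have "\<dots> = (\<Sum>i\<in>T. hausdorff_weight a (E i))"
      using T(1) a by (intro sum.cong) (auto simp: hausdorff_weight_def)
    also have "\<dots> \<le> (\<Sum>i. hausdorff_weight a (E i))"
      using T(2) by (intro sum_le_suminf) auto
    finally show "ennreal (c / 2) \<le> (\<Sum>i. hausdorff_weight a (E i))" .
  qed
  also have "\<dots> \<le> hausdorff_measure a K"
    unfolding hausdorff_measure_def using e by (intro SUP_upper) simp
  finally show ?thesis using c by (metis ennreal_less_zero_iff half_gt_zero less_le_trans)
qed

text \<open>Covering by all cylinders of level \<open>k\<close> costs at most
  \<open>card I ^ k * (r ^ k * D) powr a\<close>, which equals \<open>D powr a\<close> for every
  \<open>k\<close>; \<open>k\<close> can therefore be adapted to any scale.\<close>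

lemma hausdorff_measure_finite:
  assumes a: "0 < a" and dim: "real (card I) * r powr a = 1"
  shows "hausdorff_measure a K < \<infinity>"
proof -
  define D where "D = diameter K"
  have D0: "0 \<le> D" unfolding D_def using compact_K by (intro diameter_ge_0 compact_imp_bounded)
  have diam: "diameter (cylinder js) \<le> r ^ k * D" if "js \<in> words k" for js k
  proof -
    have "dist x y \<le> r ^ k * D" if xy: "x \<in> cylinder js" "y \<in> cylinder js" for x y
    proof -
      obtain x' y' where "x' \<in> K" "y' \<in> K" "x = compose_word S js x'" "y = compose_word S js y'"
        using xy by blast
      then show ?thesis
        using \<open>js \<in> words k\<close> r dist_compose_word[of js x' y']
          diameter_bounded_bound[OF compact_imp_bounded[OF compact_K], of x' y']
        by (simp add: D_def)
    qed
    then show ?thesis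
      using K_ne by (auto simp: diameter_def intro!: cSUP_least)
  qed
  have "hausdorff_content a d K \<le> ennreal (D powr a)" if d: "0 < d" for d
  proof -
    obtain k where k: "r ^ k * D \<le> d"
    proof (cases "D = 0")
      case True then show ?thesis using that[of 0] d by simp
    next
      case False
      then have "0 < D" using D0 by simp
      then obtain k where "r ^ k < d / D" using d r by (meson divide_pos_pos real_arch_pow_inv)
      then show ?thesis using that[of k] \<open>0 < D\<close> by (simp add: field_simps)
    qed
    obtain g where g: "bij_betw g {..<card I ^ k} (words k)"
      using ex_bij_betw_nat_finite[OF finite_words, of k]
      by (auto simp: card_words atLeast0LessThan)
    \<comment> \<open>The finite cover is padded to a sequence with empty sets, which have weight
      0.\<close>
    define E where "E i = (if i < card I ^ k then cylinder (g i) else {})" for i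
    have gw: "g i \<in> words k" if "i < card I ^ k" for i
      using g that by (auto simp: bij_betw_def)
    have "K = (\<Union>i\<in>{..<card I ^ k}. cylinder (g i))"
      using K_eq_cylinders[of k] g by (metis (no_types, lifting) SUP_cong bij_betw_imp_surj_on image_image)
    then have "K \<subseteq> (\<Union>i. E i)" by (force simp: E_def)
    moreover have "bounded (E i) \<and> diameter (E i) \<le> d" for i
      using diam[OF gw] k d compact_cylinder gw
      by (auto simp: E_def compact_imp_bounded intro: order_trans)
    ultimately have "hausdorff_content a d K \<le> (\<Sum>i. hausdorff_weight a (E i))"
      unfolding hausdorff_content_def by (intro Inf_lower) blast
    also have "\<dots> = (\<Sum>i<card I ^ k. hausdorff_weight a (E i))"
      by (intro suminf_finite) (auto simp: E_def hausdorff_weight_def)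
    also have "\<dots> \<le> (\<Sum>i<card I ^ k. ennreal ((r ^ k * D) powr a))"
    proof (rule sum_mono)
      fix i assume "i \<in> {..<card I ^ k}"
      then have i: "i < card I ^ k" by simp
      have "0 \<le> diameter (cylinder (g i))"
        using compact_cylinder gw[OF i] by (intro diameter_ge_0 compact_imp_bounded) auto
      then have "diameter (cylinder (g i)) powr a \<le> (r ^ k * D) powr a"
        using diam[OF gw[OF i]] a by (intro powr_mono2) auto
      then show "hausdorff_weight a (E i) \<le> ennreal ((r ^ k * D) powr a)"
        using i a by (auto simp: hausdorff_weight_def E_def intro: ennreal_leI)
    qed
    also have "\<dots> = ennreal (real (card I) ^ k * (r ^ k * D) powr a)"
      by (simp add: ennreal_mult' ennreal_of_nat_eq_real_of_nat flip: ennreal_power)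
    also have "real (card I) ^ k * (r ^ k * D) powr a = D powr a"
      using D0 r card_I_pos by (simp add: powr_mult flip: card_I_inverse_power[OF dim])
    finally show ?thesis .
  qed
  then have "hausdorff_measure a K \<le> ennreal (D powr a)"
    unfolding hausdorff_measure_def by (intro SUP_least) auto
  also have "\<dots> < \<infinity>" by simp
  finally show ?thesis .
qed

end

section \<open>The sets in the Heisenberg group\<close>

lemma heis_norm_dilate: "0 \<le> r \<Longrightarrow> heis_norm (heis_dilate r p) = r * heis_norm p"
  by (rule power_eq_imp_eq_base[of _ 4])
    (simp_all add: heis_norm_power4 power_mult_distrib heis_dilate_def algebra_simps flip: power_mult)

lemma heis_dilate_mult: "heis_dilate r (p \<cdot>\<^sub>H q) = heis_dilate r p \<cdot>\<^sub>H heis_dilate r q"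
  by (rule heis.expand)
    (simp add: heis_dilate_def vert_heis_mult heis_form_def algebra_simps power2_eq_square
      sum_distrib_left sum_subtractf)

lemma dist_heis_translate: "dist (heis_translate g p) (heis_translate g q) = dist p q"
  by (simp add: dist_heis_def heis_translate_def heis_inv_mult heis_mult_assoc
      flip: heis_mult_assoc[of "heis_inv g" g])

lemma dist_heis_dilate:
  assumes "0 \<le> r"
  shows "dist (heis_dilate r p) (heis_dilate r q) = r * dist p q"
proof -
  have "heis_inv (heis_dilate r p) = heis_dilate r (heis_inv p)"
    by (simp add: heis_inv_def heis_dilate_def)
  then show ?thesis
    using assms by (simp add: dist_heis_def heis_norm_dilate flip: heis_dilate_mult)
qed

section \<open>Compactness of bounded closed sets\<close>

text \<open>The distance to a fixed point is a continuous expression in the Euclidean coordinates.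
  Euclidean compact sets thus remain compact for the metric \<open>d\<close>.\<close>

lemma continuous_on_Heis: "continuous_on A (\<lambda>x. Heis (fst x) (snd x) :: 'n::finite heis)"
  unfolding continuous_on_def
proof (intro ballI)
  fix x :: "(real ^ ('n + 'n)) \<times> real"
  have "((\<lambda>y. dist (Heis (fst y) (snd y)) (Heis (fst x) (snd x) :: 'n heis)) \<longlongrightarrow>
      dist (Heis (fst x) (snd x)) (Heis (fst x) (snd x) :: 'n heis)) (at x within A)"
    unfolding dist_heis_def heis_norm_def vert_heis_mult heis_form_def
      horiz_heis_mult horiz_heis_inv vert_heis_inv heis.sel
    by (intro tendsto_intros)
  then show "((\<lambda>x. Heis (fst x) (snd x) :: 'n heis) \<longlongrightarrow> Heis (fst x) (snd x)) (at x within A)"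
    by (subst tendsto_dist_iff) simp
qed

lemma abs_vert_le: "\<bar>vert p\<bar> \<le> (heis_norm p)\<^sup>2"
proof (rule power2_le_imp_le)
  show "\<bar>vert p\<bar>\<^sup>2 \<le> ((heis_norm p)\<^sup>2)\<^sup>2"
    using heis_norm_power4[of p] by simp
qed simp

lemma bounded_heis_norm:
  assumes "bounded A"
  obtains M where "\<And>p. p \<in> A \<Longrightarrow> heis_norm p \<le> M"
proof -
  obtain M where "\<And>p. p \<in> A \<Longrightarrow> dist heis_one p \<le> M"
    using assms bounded_any_center[of A heis_one] by auto
  moreover have "dist heis_one p = heis_norm p" for p :: "'a heis"
  proof -
    have "heis_inv heis_one = (heis_one :: 'a heis)" by (simp add: heis_inv_def heis_one_def)
    then show ?thesis by (simp add: dist_heis_def)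
  qed
  ultimately show thesis using that by metis
qed

text \<open>A bound \<open>M\<close> on the norm confines the horizontal part to radius
  \<open>M\<close> and the height to \<open>M ^ 2\<close>, hence the points to a compact image of
  Euclidean balls. This makes \<open>Hutchinson\<close> applicable.\<close>

instance heis :: (finite) heine_borel
proof
  fix f :: "nat \<Rightarrow> 'a heis" assume "bounded (range f)"
  then obtain M where M: "\<And>i. heis_norm (f i) \<le> M"
    using bounded_heis_norm by (metis rangeI)
  define C where "C = (\<lambda>x. Heis (fst x) (snd x) :: 'a heis) ` (cball 0 M \<times> cball 0 (M\<^sup>2))"
  have "compact C"
    unfolding C_def by (intro compact_continuous_image continuous_on_Heis compact_Times compact_cball)
  moreover have "f i \<in> C" for i
  proof -
    have "norm (horiz (f i)) \<le> M" using norm_horiz_le[of "f i"] M[of i] by simp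
    moreover have "\<bar>vert (f i)\<bar> \<le> M\<^sup>2"
      using abs_vert_le[of "f i"] power_mono[OF M[of i], of 2] by simp
    ultimately show ?thesis
      unfolding C_def by (intro image_eqI[of _ _ "(horiz (f i), vert (f i))"]) auto
  qed
  ultimately show "\<exists>l r. strict_mono (r :: nat \<Rightarrow> nat) \<and> (f \<circ> r) \<longlonglongrightarrow> l"
    by (meson compact_def)
qed

section \<open>The family of maps and its attractor\<close>

lemma heis_familyE:
  assumes "f \<in> heis_family r"
  obtains z k where "\<And>i. z $ i \<in> {0, 1 - r}" "k \<le> 3"
    "f = heis_translate (Heis z (real k / 4)) \<circ> heis_dilate r"
proof -
  from assms obtain z k where "f = heis_translate (Heis z (real k / 4)) \<circ> heis_dilate r"
    "\<forall>i. z $ i \<in> {0, 1 - r}" "k \<in> {0, 1, 2, 3 :: nat}"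
    unfolding heis_family_def by blast
  then show thesis by (intro that[of z k]) auto
qed

lemma dist_heis_family:
  assumes "f \<in> heis_family r" "0 \<le> r"
  shows "dist (f p) (f q) = r * dist p q"
  by (rule heis_familyE[OF assms(1)]) (simp add: dist_heis_translate dist_heis_dilate assms(2))

lemma finite_heis_family:
  assumes "r \<noteq> 1"
  shows "finite (heis_family r :: ('n::finite heis \<Rightarrow> 'n heis) set)"
  using card_heis_family[OF assms, where 'n='n] by (intro card_ge_0_finite) simp

text \<open>Existence and uniqueness from \<open>Hutchinson\<close> make the definite description in
  \<open>self_similar_set\<close> denote.\<close>

lemma
  assumes r: "0 \<le> r" "r < 1"
  shows heis_K_nonempty: "heis_K r \<noteq> ({} :: 'n::finite heis set)"
    and compact_heis_K: "compact (heis_K r :: 'n heis set)"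
    and heis_K_eq: "(heis_K r :: 'n heis set) = (\<Union>f\<in>heis_family r. f ` heis_K r)"
proof -
  have "\<exists>!K :: 'n heis set. K \<noteq> {} \<and> compact K \<and> K = (\<Union>f\<in>heis_family r. f ` K)"
  proof (rule Hutchinson)
    show "finite (heis_family r :: ('n heis \<Rightarrow> _) set)" using r by (intro finite_heis_family) simp
    show "heis_family r \<noteq> ({} :: ('n heis \<Rightarrow> _) set)"
      using card_heis_family[of r, where 'n='n] r by auto
    show "dist (f x) (f y) \<le> r * dist x y" if "f \<in> heis_family r" for f and x y :: "'n heis"
      using dist_heis_family[OF that r(1)] by simp
  qed (use r in auto)
  note * = theI'[OF this, folded self_similar_set_def heis_K_def]
  from * show "heis_K r \<noteq> ({} :: 'n heis set)" by (rule conjunct1)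
  from * show "compact (heis_K r :: 'n heis set)" by (elim conjE)
  from * show "(heis_K r :: 'n heis set) = (\<Union>f\<in>heis_family r. f ` heis_K r)" by (elim conjE)
qed

section \<open>Horizontal digits and vertical fibres\<close>

lemma heis_K_horiz:
  assumes r: "0 \<le> r" "r < 1" and p: "p \<in> heis_K r"
  shows "horiz p $ i \<in> {0..1}"
proof -
  have K: "compact (heis_K r :: 'a heis set)" "heis_K r = (\<Union>f\<in>heis_family r. f ` (heis_K r :: 'a heis set))"
    using r by (rule compact_heis_K heis_K_eq)+
  have "\<bar>horiz p $ i - 1 / 2\<bar> \<le> ((1 - r) / 2) / (1 - r)"
  proof (rule self_improving_bound[OF _ r _ p])
    obtain M where M: "\<And>p. p \<in> heis_K r \<Longrightarrow> heis_norm (p :: 'a heis) \<le> M"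
      using bounded_heis_norm[OF compact_imp_bounded[OF K(1)]] by metis
    show "bdd_above ((\<lambda>p. \<bar>horiz p $ i - 1 / 2\<bar>) ` heis_K r)"
    proof (rule bdd_aboveI2)
      fix p :: "'a heis" assume "p \<in> heis_K r"
      then show "\<bar>horiz p $ i - 1 / 2\<bar> \<le> M + 1 / 2"
        using M[of p] norm_horiz_le[of p] component_le_norm_cart[of "horiz p" i] by simp
    qed
    fix p :: "'a heis" assume "p \<in> heis_K r"
    then obtain f q where f: "f \<in> heis_family r" and q: "q \<in> heis_K r" "p = f q"
      using K(2) by blast
    from f obtain z k where z: "z $ i \<in> {0, 1 - r}"
      "f = heis_translate (Heis z (real k / 4)) \<circ> heis_dilate r"
      by (elim heis_familyE) blast
    \<comment> \<open>Centring at 1/2 makes both digits deviate by exactly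
      \<open>(1 - r) / 2\<close>, since \<open>1 / 2 = (1 - r) / 2 + r * (1 / 2)\<close>.\<close>
    have "horiz p $ i - 1 / 2 = (z $ i - (1 - r) / 2) + r * (horiz q $ i - 1 / 2)"
      using q z by (simp add: heis_translate_def heis_dilate_def field_simps)
    also have "\<bar>\<dots>\<bar> \<le> \<bar>z $ i - (1 - r) / 2\<bar> + r * \<bar>horiz q $ i - 1 / 2\<bar>"
      using abs_triangle_ineq[of "z $ i - (1 - r) / 2" "r * (horiz q $ i - 1 / 2)"] r
      by (simp add: abs_mult)
    also have "\<bar>z $ i - (1 - r) / 2\<bar> = (1 - r) / 2"
      using z(1) r by (auto simp: field_simps)
    finally show "\<exists>q\<in>heis_K r. \<bar>horiz p $ i - 1 / 2\<bar> \<le> (1 - r) / 2 + r * \<bar>horiz q $ i - 1 / 2\<bar>"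
      using q by blast
  qed
  then show ?thesis using r by (auto simp: abs_le_iff field_simps)
qed

text \<open>In each coordinate, digit 0 leads into \<open>[0, r]\<close> and digit
  \<open>1 - r\<close> into \<open>[1 - r, 1]\<close>; these intervals are disjoint for
  \<open>r < 1 / 2\<close>.\<close>

lemma heis_digit_eq:
  fixes p q :: "'n::finite heis"
  assumes r: "0 \<le> r" "r < 1 / 2" and pq: "p \<in> heis_K r" "q \<in> heis_K r"
    and z: "\<And>i. z $ i \<in> {0, 1 - r}" and w: "\<And>i. w $ i \<in> {0, 1 - r}"
    and eq: "z + r *\<^sub>R horiz p = w + r *\<^sub>R horiz q"
  shows "z = w"
proof (rule vec_eq_iff[THEN iffD2, rule_format])
  fix i
  have "z $ i + r * horiz p $ i = w $ i + r * horiz q $ i"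
    using arg_cong[OF eq, of "\<lambda>x. x $ i"] by simp
  moreover have "0 \<le> r * horiz p $ i" "r * horiz p $ i \<le> r" "0 \<le> r * horiz q $ i" "r * horiz q $ i \<le> r"
    using heis_K_horiz[of r p i] heis_K_horiz[of r q i] r pq
    by (auto intro: mult_left_le)
  ultimately show "z $ i = w $ i" using z[of i] w[of i] r by auto
qed

text \<open>Since the digits agree, two points on a common fibre have preimages on a common fibre,
  so the self-improving bound applies to such pairs.\<close>

lemma heis_K_fibre:
  fixes p q :: "'n::finite heis"
  assumes r: "0 < r" "r < 1 / 2" and pq: "p \<in> heis_K r" "q \<in> heis_K r" "horiz p = horiz q"
  shows "\<bar>vert p - vert q\<bar> \<le> 1"
proof -
  have K: "compact (heis_K r :: 'n heis set)" "heis_K r = (\<Union>f\<in>heis_family r. f ` (heis_K r :: 'n heis set))"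
    using r by (intro compact_heis_K heis_K_eq; simp)+
  define X where "X = {(p, q). p \<in> heis_K r \<and> q \<in> heis_K r \<and> horiz p = (horiz q :: real ^ ('n + 'n))}"
  define v :: "'n heis \<times> 'n heis \<Rightarrow> real" where "v = (\<lambda>(p, q). \<bar>vert p - vert q\<bar>)"
  \<comment> \<open>The bound equals 1: the shifts differ by at most 3/4, and the contraction
    \<open>r ^ 2\<close> is replaced by 1/4.\<close>
  have "v (p, q) \<le> (3 / 4) / (1 - 1 / 4)"
  proof (rule self_improving_bound[where f = v and X = X])
    show "(p, q) \<in> X" using pq by (simp add: X_def)
    obtain M where M: "\<And>p. p \<in> heis_K r \<Longrightarrow> heis_norm (p :: 'n heis) \<le> M"
      using bounded_heis_norm[OF compact_imp_bounded[OF K(1)]] by metis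
    have M2: "\<bar>vert p\<bar> \<le> M\<^sup>2" if "p \<in> heis_K r" for p :: "'n heis"
      using abs_vert_le[of p] power_mono[OF M[OF that], of 2] by simp
    show "bdd_above (v ` X)"
    proof (rule bdd_aboveI2)
      fix x assume "x \<in> X"
      then show "v x \<le> 2 * M\<^sup>2"
        using M2[of "fst x"] M2[of "snd x"] by (auto simp: X_def v_def)
    qed
    fix x assume "x \<in> X"
    then obtain p q where x: "x = (p, q)" and pq: "p \<in> heis_K r" "q \<in> heis_K r" "horiz p = horiz q"
      by (auto simp: X_def)
    obtain f p' where f: "f \<in> heis_family r" and p': "p' \<in> heis_K r" "p = f p'" using pq(1) K(2) by blast
    obtain g q' where g: "g \<in> heis_family r" and q': "q' \<in> heis_K r" "q = g q'" using pq(2) K(2) by blast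
    obtain z k where z: "\<And>i. z $ i \<in> {0, 1 - r}" "k \<le> 3"
      "f = heis_translate (Heis z (real k / 4)) \<circ> heis_dilate r"
      using f by (elim heis_familyE) blast
    obtain w l where w: "\<And>i. w $ i \<in> {0, 1 - r}" "l \<le> 3"
      "g = heis_translate (Heis w (real l / 4)) \<circ> heis_dilate r"
      using g by (elim heis_familyE) blast
    have eq: "z + r *\<^sub>R horiz p' = w + r *\<^sub>R horiz q'"
      using pq(3) p' q' z w by (simp add: heis_translate_def heis_dilate_def)
    then have zw: "z = w"
      using heis_digit_eq[of r p' q' z w] p' q' r z(1) w(1) by simp
    then have h: "horiz p' = horiz q'" using eq r by simp
    \<comment> \<open>The twisting terms \<open>heis_form\<close> of both points depend on the same
      digit and the same horizontal part, so they cancel.\<close>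
    have "vert p - vert q = (real k - real l) / 4 + r\<^sup>2 * (vert p' - vert q')"
      using p' q' z w zw h
      by (simp add: heis_translate_def heis_dilate_def vert_heis_mult heis_form_def field_simps)
    also have "\<bar>\<dots>\<bar> \<le> \<bar>(real k - real l) / 4\<bar> + r\<^sup>2 * \<bar>vert p' - vert q'\<bar>"
      by (rule order_trans[OF abs_triangle_ineq]) (simp add: abs_mult)
    also have "\<dots> \<le> 3 / 4 + 1 / 4 * \<bar>vert p' - vert q'\<bar>"
      using z(2) w(2) power_mono[of r "1 / 2" 2] r
      by (intro add_mono mult_right_mono) (auto simp: power_divide)
    finally show "\<exists>y\<in>X. v x \<le> 3 / 4 + 1 / 4 * v y"
      using p' q' h x by (intro bexI[of _ "(p', q')"]) (auto simp: X_def v_def)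
  qed auto
  then show ?thesis by (simp add: v_def)
qed

text \<open>Pieces that meet have the same horizontal digit, so only the shifts \<open>k / 4\<close>
  and \<open>l / 4\<close> can differ. Their difference is a fibre height scaled by
  \<open>r ^ 2 < 1 / 4\<close>, which forces \<open>k = l\<close>.\<close>

lemma heis_family_disjoint:
  fixes f g :: "'n::finite heis \<Rightarrow> 'n heis"
  assumes r: "0 < r" "r < 1 / 2" and fg: "f \<in> heis_family r" "g \<in> heis_family r" "f \<noteq> g"
  shows "f ` heis_K r \<inter> g ` heis_K r = {}"
proof (rule ccontr)
  assume "f ` heis_K r \<inter> g ` heis_K r \<noteq> {}"
  then obtain p q where pq: "p \<in> heis_K r" "q \<in> heis_K r" "f p = g q" by auto
  obtain z k where z: "\<And>i. z $ i \<in> {0, 1 - r}"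
    "f = heis_translate (Heis z (real k / 4)) \<circ> heis_dilate r"
    using fg(1) by (elim heis_familyE) blast
  obtain w l where w: "\<And>i. w $ i \<in> {0, 1 - r}"
    "g = heis_translate (Heis w (real l / 4)) \<circ> heis_dilate r"
    using fg(2) by (elim heis_familyE) blast
  have eq: "z + r *\<^sub>R horiz p = w + r *\<^sub>R horiz q"
    using arg_cong[OF pq(3), of horiz] z w by (simp add: heis_translate_def heis_dilate_def)
  then have zw: "z = w"
    using heis_digit_eq[of r p q z w] pq r z(1) w(1) by simp
  then have h: "horiz p = horiz q" using eq r by simp
  have v: "(real l - real k) / 4 = r\<^sup>2 * (vert p - vert q)"
    using arg_cong[OF pq(3), of vert] z w zw h
    by (simp add: heis_translate_def heis_dilate_def vert_heis_mult heis_form_def field_simps)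
  have "\<bar>r\<^sup>2 * (vert p - vert q)\<bar> \<le> r\<^sup>2 * 1"
    unfolding abs_mult using heis_K_fibre[OF r pq(1,2) h] by (intro mult_mono) auto
  also have "r\<^sup>2 < (1 / 2)\<^sup>2" using r by (intro power_strict_mono) auto
  finally have "\<bar>(real l - real k) / 4\<bar> < 1 / 4"
    unfolding v by (simp add: power_divide)
  then have "k = l" by simp
  with zw z w fg(3) show False by simp
qed

section \<open>Application to \<open>heis_K r\<close> with its similarity dimension\<close>

theorem theorem4p2:
  fixes r a :: real
    and N :: nat
    and S :: "nat \<Rightarrow> 'n::finite heis \<Rightarrow> 'n heis"
  assumes r: "r \<in> {0<..<1/2}"
    and N: "N = 2 ^ (2 * CARD('n) + 2)"
    and S: "bij_betw S {1..N} (heis_family r)"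
    and a: "a = real (2 * CARD('n) + 2) * ln 2 / ln (1 / r)"
  shows "disjoint_family_on (\<lambda>j. S j ` heis_K r) {1..N}
    \<and> heis_K r = (\<Inter>k\<in>{1..}. \<Union>js\<in>{js. length js = k \<and> set js \<subseteq> {1..N}}.
                     compose_word S js ` heis_K r)
    \<and> 0 < hausdorff_measure a (heis_K r :: 'n heis set)
    \<and> hausdorff_measure a (heis_K r :: 'n heis set) < \<infinity>"
proof -
  have r': "0 < r" "r < 1 / 2" using r by auto
  have K: "heis_K r \<noteq> ({} :: 'n heis set)" "compact (heis_K r :: 'n heis set)"
    "heis_K r = (\<Union>f\<in>heis_family r. f ` (heis_K r :: 'n heis set))"
    using r' by (intro heis_K_nonempty compact_heis_K heis_K_eq; simp)+
  have disj: "disjoint_family_on (\<lambda>j. S j ` heis_K r) {1..N}"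
    unfolding disjoint_family_on_def
    using heis_family_disjoint[OF r'] bij_betwE[OF S] bij_betw_imp_inj_on[OF S] inj_on_eq_iff
    by metis
  interpret separated_similarities S "{1..N}" "heis_K r" r
  proof
    show "dist (S i x) (S i y) = r * dist x y" if "i \<in> {1..N}" for i x y
      using bij_betwE[OF S] that r' by (intro dist_heis_family) auto
    show "heis_K r = (\<Union>i\<in>{1..N}. S i ` heis_K r)"
      using K(3) unfolding bij_betw_imp_surj_on[OF S, symmetric] image_image .
  qed (use r' K(1,2) disj in auto)
  have "0 < ln (1 / r)" using r' by simp
  then have a0: "0 < a" unfolding a by (intro divide_pos_pos mult_pos_pos) auto
  \<comment> \<open>With \<open>N = 2 ^ m\<close> and \<open>a * ln r = - (m * ln 2)\<close>, the
    dimension equation \<open>N * r powr a = 1\<close> follows by taking exponentials.\<close>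
  define m where "m = 2 * CARD('n) + 2"
  have N': "real N = exp (real m * ln 2)"
    unfolding N m_def[symmetric] by (simp add: exp_of_nat_mult)
  have "a * ln r = - (real m * ln 2)"
    unfolding a m_def[symmetric] using r' by (simp add: ln_div)
  then have "real N * r powr a = 1"
    using r' by (simp add: N' powr_def exp_minus)
  then have "real (card {1..N}) * r powr a = 1" by simp
  note measure = hausdorff_measure_pos[OF a0 this] hausdorff_measure_finite[OF a0 this]
  \<comment> \<open>Each union in the intersection already equals \<open>heis_K r\<close>, which
    leaves a constant intersection over a nonempty index set.\<close>
  show ?thesis
    unfolding K_eq_cylinders[symmetric] using disj measure by auto
qed

end
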